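(* Let $a\ge 1$ be an integer, let $L\subseteq\{0,1,\dots,a-1\}$ and put $\ell=|L|$. For all integers $n\ge 0$ and $k$, $$g_{a,0,\ell,\ell}(n,k)=\#A_L(n,k)\qquad\text{and}\qquad g_{0,a,\ell-a,\ell}(n,k)=\#B_L(n,k),$$ where $A_L(n,k)=\{\sigma\in C_a\wr S_n : \overleftarrow{\min}_L(\sigma)=k\}$ and $B_L(n,k)=\{\sigma\in C_a\wr S_n : des_L(\sigma)=\overleftarrow{\min}_L(\sigma)=k\}$.
   Context: For integers $A,D,R,\Lambda$ the numbers $g_{A,D,R,\Lambda}(n,k)$ ($n\ge0$, $k\in\mathbb Z$) are defined by $g(0,0)=1$, $g(n,k)=0$ if $k<0$ or $k>n$, and for $n\ge1$, $0\le k\le n$: $g(n,k)=(An+Dk-R)\,g(n-1,k)+\Lambda\, g(n-1,k-1)$. Let $\alpha=e^{2\pi i/a}$ and $C_a=\{\alpha^t:0\le t\le a-1\}$. The wreath product $C_a\wr S_n$ is identified with the group (under composition) of bijections $\sigma$ of $\{\alpha^v j: 0\le v\le a-1,\ 1\le j\le n\}$ satisfying $\sigma(\beta j)=\beta\sigma(j)$ for $\beta\in C_a$; we write $\sigma=[\sigma(1),\dots,\sigma(n)]$, $\sigma(j)=\alpha^{t_j}|\sigma(j)|$ with $|\sigma(j)|\in\{1,\dots,n\}$ ($\alpha^{t_j}$ is the color of $\sigma(j)$), and $|\sigma|=[|\sigma(1)|,\dots,|\sigma(n)|]\in S_n$. We set $\sigma(0)=0$. For $C_a\wr S_0$ (the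 trivial group) all statistics below are $0$. Colored right-to-left minima: $\overleftarrow{\mathrm{Min}}_L(\sigma)$ is the set of values $|\sigma(i)|$ such that $|\sigma(i)|<|\sigma(j)|$ for all $j>i$ (a right-to-left minimum of $|\sigma|$) and $\sigma(i)=\alpha^u|\sigma(i)|$ with $u\in L$; $\overleftarrow{\min}_L(\sigma)=|\overleftarrow{\mathrm{Min}}_L(\sigma)|$. The $L$-order: let $U=\{0,\dots,a-1\}\setminus L$. Define a linear order $<_L$ on $\{\alpha^v j:0\le v\le a-1,1\le j\le n\}\cup\{0\}$ by: $\alpha^v j<_L 0$ if $v\in L$; $\alpha^v j>_L0$ if $v\in U$; for $u,v\in L$ and $i\ne j$, $\alpha^v i<_L\alpha^u j$ iff $i>j$; for $u,v\in U$ and $i\ne j$, $\alpha^v i<_L\alpha^u j$ iff $i<j$; elements $\alpha^v j$ with the same $j$ and $v$ in the same one of $L,U$ are ordered arbitrarily (this does not affect descents below). The $L$-descent set is $Des_L(\sigma)=\{0\le i\le n-1:\sigma(i)>_L\sigma(i+1)\}$ (with $\sigma(0)=0$) and $des_L(\sigma)=|Des_L(\sigma)|$. *)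

theory Defs
  imports Complex_Main "HOL-Combinatorics.Permutations"
begin

fun g :: "int \<Rightarrow> int \<Rightarrow> int \<Rightarrow> int \<Rightarrow> nat \<Rightarrow> int \<Rightarrow> int" where
  "g A D R \<Lambda> 0 k = (if k = 0 then 1 else 0)"
| "g A D R \<Lambda> (Suc n) k =
     (if k < 0 \<or> k > int (Suc n) then 0
      else (A * int (Suc n) + D * k - R) * g A D R \<Lambda> n k + \<Lambda> * g A D R \<Lambda> n (k - 1))"

definition root_unity :: "nat \<Rightarrow> complex" where
  "root_unity a = cis (2 * pi / real a)"

definition colored :: "nat \<Rightarrow> nat \<Rightarrow> nat \<Rightarrow> complex" where
  "colored a v j = root_unity a ^ v * of_nat j"

definition colored_set :: "nat \<Rightarrow> nat \<Rightarrow> complex set" where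
  "colored_set a n = {colored a v j | v j. v < a \<and> 1 \<le> j \<and> j \<le> n}"

text \<open>
  A bijection of \<^term>\<open>colored_set a n\<close> is extended by the identity to all complex numbers.
  Since \<open>0\<close> is not a colored element, this includes the convention \<open>\<sigma> 0 = 0\<close>.
\<close>

definition wreath :: "nat \<Rightarrow> nat \<Rightarrow> (complex \<Rightarrow> complex) set" where
  "wreath a n = {\<sigma>. \<sigma> permutes colored_set a n \<and>
     (\<forall>t<a. \<forall>x\<in>colored_set a n. \<sigma> (root_unity a ^ t * x) = root_unity a ^ t * \<sigma> x)}"

text \<open>
  Since the colors have modulus \<open>1\<close>, the value \<open>\<bar>\<sigma>(i)\<bar>\<close> is the complex modulus of \<open>\<sigma>(i)\<close>.
\<close>

definition rl_Min :: "nat \<Rightarrow> nat set \<Rightarrow> nat \<Rightarrow> (complex \<Rightarrow> complex) \<Rightarrow> real set" where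
  "rl_Min a L n \<sigma> = {cmod (\<sigma> (of_nat i)) | i. 1 \<le> i \<and> i \<le> n \<and>
     (\<forall>j. i < j \<and> j \<le> n \<longrightarrow> cmod (\<sigma> (of_nat i)) < cmod (\<sigma> (of_nat j))) \<and>
     (\<exists>u\<in>L. \<sigma> (of_nat i) = root_unity a ^ u * of_real (cmod (\<sigma> (of_nat i))))}"

definition rl_min :: "nat \<Rightarrow> nat set \<Rightarrow> nat \<Rightarrow> (complex \<Rightarrow> complex) \<Rightarrow> nat" where
  "rl_min a L n \<sigma> = card (rl_Min a L n \<sigma>)"

text \<open>
  An \<open>L\<close>-order is given as its set of pairs \<open>(x, y)\<close> with \<open>x <\<^sub>L y\<close>. Elements with the same
  absolute value whose colors are both in \<open>L\<close>, or both outside \<open>L\<close>, may be ordered in any way, so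
  there are several \<open>L\<close>-orders; the lemma \<open>L_order_exists\<close> below shows that there is at least one.
\<close>

definition L_order :: "nat \<Rightarrow> nat set \<Rightarrow> nat \<Rightarrow> (complex \<times> complex) set \<Rightarrow> bool" where
  "L_order a L n r \<longleftrightarrow>
     (let S = insert 0 (colored_set a n); U = {..<a} - L in
       r \<subseteq> S \<times> S \<and> strict_linear_order_on S r \<and>
       (\<forall>v\<in>L. \<forall>j\<in>{1..n}. (colored a v j, 0) \<in> r) \<and>
       (\<forall>v\<in>U. \<forall>j\<in>{1..n}. (0, colored a v j) \<in> r) \<and>
       (\<forall>u\<in>L. \<forall>v\<in>L. \<forall>i\<in>{1..n}. \<forall>j\<in>{1..n}. i \<noteq> j \<longrightarrow>
          ((colored a v i, colored a u j) \<in> r \<longleftrightarrow> i > j)) \<and>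
       (\<forall>u\<in>U. \<forall>v\<in>U. \<forall>i\<in>{1..n}. \<forall>j\<in>{1..n}. i \<noteq> j \<longrightarrow>
          ((colored a v i, colored a u j) \<in> r \<longleftrightarrow> i < j)))"

definition Des :: "nat \<Rightarrow> (complex \<times> complex) set \<Rightarrow> (complex \<Rightarrow> complex) \<Rightarrow> nat set" where
  "Des n r \<sigma> = {i. i < n \<and> (\<sigma> (of_nat (i + 1)), \<sigma> (of_nat i)) \<in> r}"

definition des :: "nat \<Rightarrow> (complex \<times> complex) set \<Rightarrow> (complex \<Rightarrow> complex) \<Rightarrow> nat" where
  "des n r \<sigma> = card (Des n r \<sigma>)"

definition A_set :: "nat \<Rightarrow> nat set \<Rightarrow> nat \<Rightarrow> int \<Rightarrow> (complex \<Rightarrow> complex) set" where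
  "A_set a L n k = {\<sigma> \<in> wreath a n. int (rl_min a L n \<sigma>) = k}"

definition B_set :: "nat \<Rightarrow> nat set \<Rightarrow> (complex \<times> complex) set \<Rightarrow> nat \<Rightarrow> int
    \<Rightarrow> (complex \<Rightarrow> complex) set" where
  "B_set a L r n k =
     {\<sigma> \<in> wreath a n. int (des n r \<sigma>) = k \<and> int (rl_min a L n \<sigma>) = k}"

lemma cmod_colored: "cmod (colored a v j) = real j"
  by (simp add: colored_def root_unity_def norm_mult norm_power)

lemma root_unity_power_inject:
  assumes "u < a" "v < a" "root_unity a ^ u = root_unity a ^ v"
  shows "u = v"
proof -
  have "inj_on (\<lambda>k. cis (2 * pi * real k / real a)) {..<a}"
    using bij_betw_roots_unity[of a] assms(1) by (auto simp: bij_betw_def)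
  moreover have "root_unity a ^ k = cis (2 * pi * real k / real a)" for k
    by (simp add: root_unity_def DeMoivre mult_ac)
  ultimately show ?thesis
    using assms by (auto dest: inj_onD)
qed

lemma colored_inject:
  assumes "u < a" "v < a" "1 \<le> i" "colored a u i = colored a v j"
  shows "u = v \<and> i = j"
proof -
  have "i = j"
    using assms(4) cmod_colored by (metis of_nat_eq_iff)
  with assms root_unity_power_inject show ?thesis
    by (auto simp: colored_def)
qed

lemma finite_colored_set: "finite (colored_set a n)"
proof -
  have "colored_set a n \<subseteq> (\<lambda>(v, j). colored a v j) ` ({..<a} \<times> {1..n})"
    by (force simp: colored_set_def)
  then show ?thesis
    by (rule finite_subset) simp
qed

lemma finite_wreath: "finite (wreath a n)"
  by (rule finite_subset[OF _ finite_permutations[OF finite_colored_set[of a n]]])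
    (auto simp: wreath_def)

lemma L_order_exists:
  assumes "L \<subseteq> {..<a}"
  shows "\<exists>r. L_order a L n r"
proof -
  define S where "S = insert 0 (colored_set a n)"
  have "finite S"
    by (simp add: S_def finite_colored_set)
  then obtain f :: "complex \<Rightarrow> nat" where f: "inj_on f S"
    using finite_imp_inj_to_nat_seg by metis
  define key :: "complex \<Rightarrow> real" where
    "key z = (if \<exists>v\<in>L. z = root_unity a ^ v * of_real (cmod z) then - cmod z else cmod z)" for z
  define r where "r = {(x, y) \<in> S \<times> S. key x < key y \<or> key x = key y \<and> f x < f y}"
  have key0: "key 0 = 0"
    by (simp add: key_def)
  have keyL: "key (colored a v j) = - real j" if "v \<in> L" for v j
    using that unfolding key_def cmod_colored by (auto simp: colored_def)
  have keyU: "key (colored a v j) = real j" if "v < a" "v \<notin> L" "1 \<le> j" for v j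
  proof -
    have "colored a v j \<noteq> root_unity a ^ u * of_real (cmod (colored a v j))" if "u \<in> L" for u
    proof
      assume "colored a v j = root_unity a ^ u * of_real (cmod (colored a v j))"
      then have "colored a v j = colored a u j"
        unfolding cmod_colored by (simp add: colored_def)
      moreover have "u < a" using \<open>u \<in> L\<close> assms by auto
      ultimately have "v = u"
        using colored_inject \<open>v < a\<close> \<open>1 \<le> j\<close> by blast
      with \<open>u \<in> L\<close> \<open>v \<notin> L\<close> show False by simp
    qed
    then have "\<not> (\<exists>u\<in>L. colored a v j = root_unity a ^ u * of_real (cmod (colored a v j)))"
      by blast
    then show ?thesis
      by (simp only: key_def if_False cmod_colored)
  qed
  have mem: "colored a v j \<in> S" if "v < a" "j \<in> {1..n}" for v j
    using that by (auto simp: S_def colored_set_def)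
  have mem0: "0 \<in> S"
    by (simp add: S_def)
  have Lless: "v < a" if "v \<in> L" for v
    using that assms by auto
  have "strict_linear_order_on S r"
    unfolding strict_linear_order_on_def
  proof (intro conjI)
    show "trans r"
      by (rule transI) (auto simp: r_def)
    show "irrefl r"
      by (auto simp: irrefl_def r_def)
    show "total_on S r"
    proof (rule total_onI)
      fix x y assume xy: "x \<in> S" "y \<in> S" "x \<noteq> y"
      with f have "f x \<noteq> f y" by (auto dest: inj_onD)
      with xy show "(x, y) \<in> r \<or> (y, x) \<in> r"
        unfolding r_def by auto
    qed
  qed
  moreover have "r \<subseteq> S \<times> S"
    by (auto simp: r_def)
  moreover have "\<forall>v\<in>L. \<forall>j\<in>{1..n}. (colored a v j, 0) \<in> r"
    by (auto simp: r_def key0 keyL mem mem0 Lless)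
  moreover have "\<forall>v\<in>{..<a} - L. \<forall>j\<in>{1..n}. (0, colored a v j) \<in> r"
    by (auto simp: r_def key0 keyU mem mem0)
  moreover have "\<forall>u\<in>L. \<forall>v\<in>L. \<forall>i\<in>{1..n}. \<forall>j\<in>{1..n}. i \<noteq> j \<longrightarrow>
      ((colored a v i, colored a u j) \<in> r \<longleftrightarrow> i > j)"
    by (auto simp: r_def keyL mem Lless)
  moreover have "\<forall>u\<in>{..<a} - L. \<forall>v\<in>{..<a} - L. \<forall>i\<in>{1..n}. \<forall>j\<in>{1..n}. i \<noteq> j \<longrightarrow>
      ((colored a v i, colored a u j) \<in> r \<longleftrightarrow> i < j)"
    by (auto simp: r_def keyU mem)
  ultimately have "L_order a L n r"
    unfolding L_order_def Let_def S_def by blast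
  then show ?thesis ..
qed

end

theory Submission
  imports Defs
begin

text \<open>
  Write \<open>\<sigma>\<close> as the word of its colored letters and insert the letter of largest absolute value
  \<open>n + 1\<close> into a word with \<open>n\<close> letters. This creates a right-to-left minimum with color in \<open>L\<close>
  exactly when the letter goes to the end with a color in \<open>L\<close>, and never destroys one; this gives
  the first recurrence. In the \<open>L\<close>-order the new letter is the maximum or the minimum. It leaves
  the number of descents unchanged when it is put into a descent, and adds one when it is put into
  an ascent; at the end it adds a descent exactly when its color is in \<open>L\<close>. Hence
  \<open>rl_min \<le> des\<close> always, and equality is preserved exactly by the insertions into one of the \<open>k\<close>
  descents and at the end, which gives the second recurrence.
\<close>

section \<open>Insertion of a letter into a list\<close>

definition insert_at :: "nat \<Rightarrow> 'a \<Rightarrow> 'a list \<Rightarrow> 'a list" where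
  "insert_at i x xs = take i xs @ x # drop i xs"

lemma insert_at_0 [simp]: "insert_at 0 x xs = x # xs"
  by (simp add: insert_at_def)

lemma insert_at_Suc [simp]: "insert_at (Suc i) x (y # ys) = y # insert_at i x ys"
  by (simp add: insert_at_def)

lemma set_insert_at [simp]: "set (insert_at i x xs) = insert x (set xs)"
  by (simp add: insert_at_def) (metis append_take_drop_id set_append)

lemma length_insert_at [simp]: "length (insert_at i x xs) = Suc (length xs)"
  by (simp add: insert_at_def)

lemma map_insert_at: "map f (insert_at i x xs) = insert_at i (f x) (map f xs)"
  by (simp add: insert_at_def take_map drop_map)

lemma distinct_insert_at [simp]: "distinct (insert_at i x xs) \<longleftrightarrow> x \<notin> set xs \<and> distinct xs"
proof -
  have "mset (insert_at i x xs) = mset (x # xs)"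
    by (simp add: insert_at_def) (metis append_take_drop_id mset_append)
  then show ?thesis
    by (metis distinct.simps(2) mset_eq_imp_distinct_iff)
qed

text \<open>Separating position 0 from the rest turns statistics counted by positions into
  recursions along the list; both descents and right-to-left minima are handled this way.\<close>

lemma card_less_Suc_split:
  "card {i. i < Suc n \<and> P i} = (if P 0 then 1 else 0) + card {i. i < n \<and> P (Suc i)}"
proof -
  have "{i. i < Suc n \<and> P i} = (if P 0 then {0} else {}) \<union> Suc ` {i. i < n \<and> P (Suc i)}"
    by (auto simp: image_iff less_Suc_eq_0_disj)
  then show ?thesis
    by (simp add: card_Un_disjoint card_image)
qed

section \<open>Descents under insertion of an extreme letter\<close>

text \<open>The entry \<open>p\<close> stands in front of the word, so \<open>(p # xs) ! i\<close>
  is the predecessor of \<open>xs ! i\<close>. It becomes 0 for the convention \<sigma>(0) = 0;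
  keeping it general lets inductions pass to the tail with the head as new predecessor.\<close>

definition descents :: "'a::linorder \<Rightarrow> 'a list \<Rightarrow> nat set" where
  "descents p xs = {i. i < length xs \<and> xs ! i < (p # xs) ! i}"

lemma finite_descents [simp]: "finite (descents p xs)"
  by (simp add: descents_def)

lemma zero_in_descents_Cons [simp]: "0 \<in> descents p (x # xs) \<longleftrightarrow> x < p"
  by (simp add: descents_def)

lemma Suc_in_descents_Cons [simp]: "Suc i \<in> descents p (x # xs) \<longleftrightarrow> i \<in> descents x xs"
  by (simp add: descents_def)

lemma descents_Nil [simp]: "descents p [] = {}"
  by (simp add: descents_def)

lemma card_descents_Cons:
  "card (descents p (x # xs)) = (if x < p then 1 else 0) + card (descents x xs)"
  unfolding descents_def by (simp add: card_less_Suc_split)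

text \<open>A maximum put between neighbours u and v replaces the pair (u, v) by an ascent and a
  descent: nothing changes if (u, v) was a descent, and one descent is gained otherwise. At the end
  only an ascent is appended.\<close>

lemma card_descents_insert_max:
  assumes "\<forall>y\<in>set (p # xs). y < x" "i \<le> length xs"
  shows "card (descents p (insert_at i x xs)) =
    card (descents p xs) + (if i \<in> descents p xs \<or> i = length xs then 0 else 1)"
  using assms
proof (induction xs arbitrary: p i)
  case Nil
  then show ?case by (auto simp: card_descents_Cons)
next
  case (Cons y ys)
  then show ?case by (cases i) (auto simp: card_descents_Cons)
qed

text \<open>Dually, the pair is replaced by a descent followed by an ascent. At the end a descent is
  appended; the formula covers this since \<open>length xs\<close> is never in
  \<open>descents p xs\<close>.\<close>

lemma card_descents_insert_min:
  assumes "\<forall>y\<in>set (p # xs). x < y" "i \<le> length xs"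
  shows "card (descents p (insert_at i x xs)) =
    card (descents p xs) + (if i \<in> descents p xs then 0 else 1)"
  using assms
proof (induction xs arbitrary: p i)
  case Nil
  then show ?case by (auto simp: card_descents_Cons)
next
  case (Cons y ys)
  then show ?case by (cases i) (auto simp: card_descents_Cons)
qed

section \<open>Colored permutations as words\<close>

text \<open>A letter \<open>(c, j)\<close> stands for the colored number \<open>\<alpha>\<^sup>c j\<close>.\<close>

definition words :: "nat \<Rightarrow> nat \<Rightarrow> (nat \<times> nat) list set" where
  "words a n = {w. length w = n \<and> fst ` set w \<subseteq> {..<a} \<and> distinct (map snd w) \<and>
     snd ` set w = {1..n}}"

text \<open>Positions are collected instead of values; the absolute values in a word are distinct,
  so both counts agree.\<close>

definition rlm_positions :: "nat set \<Rightarrow> (nat \<times> nat) list \<Rightarrow> nat set" where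
  "rlm_positions L w = {i. i < length w \<and> fst (w ! i) \<in> L \<and>
     (\<forall>j. i < j \<and> j < length w \<longrightarrow> snd (w ! i) < snd (w ! j))}"

definition rlm :: "nat set \<Rightarrow> (nat \<times> nat) list \<Rightarrow> nat" where
  "rlm L w = card (rlm_positions L w)"

text \<open>The \<open>L\<close>-order on letters of distinct absolute values is the order of their keys.\<close>

definition key :: "nat set \<Rightarrow> nat \<times> nat \<Rightarrow> int" where
  "key L x = (if fst x \<in> L then - int (snd x) else int (snd x))"

definition word_Des :: "nat set \<Rightarrow> (nat \<times> nat) list \<Rightarrow> nat set" where
  "word_Des L w = descents 0 (map (key L) w)"

lemma rlm_Nil [simp]: "rlm L [] = 0"
  by (simp add: rlm_def rlm_positions_def)

lemma rlm_Cons: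
  "rlm L (x # w) = (if fst x \<in> L \<and> (\<forall>y\<in>set w. snd x < snd y) then 1 else 0) + rlm L w"
proof -
  have all: "(\<forall>j. 0 < j \<and> j < Suc (length w) \<longrightarrow> snd x < snd ((x # w) ! j)) \<longleftrightarrow>
      (\<forall>y\<in>set w. snd x < snd y)"
    by (force simp: all_set_conv_all_nth gr0_conv_Suc)
  \<comment> \<open>Index shift: position \<open>Suc i\<close> of \<open>x # w\<close> sees the same
    later letters as position \<open>i\<close> of \<open>w\<close>.\<close>
  have step: "(\<forall>j. Suc i < j \<and> j < Suc (length w) \<longrightarrow> m < snd ((x # w) ! j)) \<longleftrightarrow>
      (\<forall>j. i < j \<and> j < length w \<longrightarrow> m < snd (w ! j))" for i m
    by (auto simp: Suc_less_eq2)
  show ?thesis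
    unfolding rlm_def rlm_positions_def
    by (simp only: list.size add_Suc_right add_0_right card_less_Suc_split nth_Cons_0 nth_Cons_Suc
        all step)
qed

text \<open>A larger letter appearing further right violates no minimality condition, and the new
  letter is itself minimal only if nothing follows it.\<close>

lemma rlm_insert_max:
  assumes "\<forall>y\<in>set w. snd y < m" "i \<le> length w"
  shows "rlm L (insert_at i (c, m) w) = rlm L w + (if i = length w \<and> c \<in> L then 1 else 0)"
  using assms
proof (induction w arbitrary: i)
  case Nil
  then show ?case by (simp add: rlm_Cons)
next
  case (Cons y w)
  then show ?case by (cases i) (auto simp: rlm_Cons)
qed

lemma words_0: "words a 0 = {[]}"
  by (auto simp: words_def)

lemma words_letter:
  assumes "w \<in> words a n" "x \<in> set w"
  shows "fst x < a" "1 \<le> snd x" "snd x \<le> n"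
proof -
  have "fst x \<in> fst ` set w" "snd x \<in> snd ` set w"
    using assms by blast+
  moreover have "fst ` set w \<subseteq> {..<a}" "snd ` set w = {1..n}"
    using assms by (simp_all add: words_def)
  ultimately show "fst x < a" "1 \<le> snd x" "snd x \<le> n"
    by auto
qed

lemma words_letter_less: "w \<in> words a n \<Longrightarrow> x \<in> set w \<Longrightarrow> snd x < Suc n"
  using words_letter(3) by (simp add: less_Suc_eq_le)

lemma words_length: "w \<in> words a n \<Longrightarrow> length w = n"
  by (simp add: words_def)

lemma finite_words: "finite (words a n)"
proof (rule finite_subset)
  show "words a n \<subseteq> {w. set w \<subseteq> {..<a} \<times> {1..n} \<and> length w = n}"
  proof
    fix w assume w: "w \<in> words a n"
    show "w \<in> {w. set w \<subseteq> {..<a} \<times> {1..n} \<and> length w = n}"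
      using words_letter[OF w] words_length[OF w] by force
  qed
  show "finite {w. set w \<subseteq> {..<a} \<times> {1..n} \<and> length w = n}"
    by (rule finite_lists_length_eq) simp
qed

section \<open>Insertion of the largest letter and its effect on the statistics\<close>

text \<open>The inverse deletes the letter of absolute value \<open>Suc n\<close>. It occurs exactly
  once, so its color, its position and the remaining word can be read off.\<close>

lemma bij_betw_insert_words:
  "bij_betw (\<lambda>(w, i, c). insert_at i (c, Suc n) w)
     (words a n \<times> {..n} \<times> {..<a}) (words a (Suc n))"
  (is "bij_betw ?f ?S ?T")
proof (rule bij_betw_imageI)
  show "inj_on ?f ?S"
  proof (rule inj_onI)
    fix x x' assume "x \<in> ?S" "x' \<in> ?S" "?f x = ?f x'"
    moreover obtain w i c w' i' c' where x: "x = (w, i, c)" "x' = (w', i', c')"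
      by (metis prod_cases3)
    ultimately have w: "w \<in> words a n" "w' \<in> words a n" and i: "i \<in> {..n}" "i' \<in> {..n}"
      and eq: "insert_at i (c, Suc n) w = insert_at i' (c', Suc n) w'"
      by simp_all
    have nin: "(d, Suc n) \<notin> set w" "(d, Suc n) \<notin> set w'" for d
      using w words_letter_less by force+
    have "(c, Suc n) \<in> set (insert_at i' (c', Suc n) w')"
      by (simp flip: eq)
    then have c: "c = c'"
      using nin by simp
    have "take i w @ (c, Suc n) # drop i w = take i' w' @ (c, Suc n) # drop i' w'"
      using eq by (simp add: insert_at_def c)
    \<comment> \<open>The inserted letter occurs in none of the four pieces, so the splitting around
      it is unique.\<close>
    then have td: "take i w = take i' w' \<and> drop i w = drop i' w'"
      using nin by (subst (asm) append_Cons_eq_iff) (auto dest: in_set_takeD in_set_dropD)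
    then have "length (take i w) = length (take i' w')"
      by simp
    then have "i = i'"
      using i w by (simp add: words_length)
    with td c show "x = x'"
      unfolding x by (metis append_take_drop_id)
  qed
  show "?f ` ?S = ?T"
  proof (intro equalityI subsetI)
    fix w' assume "w' \<in> ?f ` ?S"
    then obtain w i c where *: "w \<in> words a n" "i \<le> n" "c < a" "w' = insert_at i (c, Suc n) w"
      by auto
    then have "Suc n \<notin> snd ` set w"
      by (simp add: words_def)
    with * show "w' \<in> ?T"
      by (auto simp: words_def map_insert_at)
  next
    fix w' assume w': "w' \<in> ?T"
    then have "Suc n \<in> snd ` set w'"
      by (auto simp: words_def)
    then obtain c where c: "(c, Suc n) \<in> set w'"
      by auto
    then obtain u v where uv: "w' = u @ (c, Suc n) # v"
      by (meson split_list)
    define w where "w = u @ v"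
    have ins: "w' = insert_at (length u) (c, Suc n) w"
      by (simp add: uv w_def insert_at_def)
    have len: "length w = n"
      using w' by (simp add: ins words_def)
    have *: "Suc n \<notin> snd ` set w" "distinct (map snd w)" "insert (Suc n) (snd ` set w) = {1..Suc n}"
      using w' by (simp_all add: ins words_def map_insert_at)
    then have "snd ` set w = {1..Suc n} - {Suc n}"
      by (metis Diff_insert_absorb)
    also have "\<dots> = {1..n}"
      by auto
    finally have "w \<in> words a n"
      using w' len * by (auto simp: words_def ins)
    moreover have "length u \<le> n" "c < a"
      using len c w' by (auto simp: w_def words_def)
    ultimately show "w' \<in> ?f ` ?S"
      using ins by (auto intro!: image_eqI[of _ _ "(w, length u, c)"])
  qed
qed

lemma rlm_insert_words:
  assumes "w \<in> words a n" "i \<le> n"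
  shows "rlm L (insert_at i (c, Suc n) w) = rlm L w + (if i = n \<and> c \<in> L then 1 else 0)"
  using assms rlm_insert_max[of w "Suc n" i L c]
  by (auto simp: words_letter_less words_length)

text \<open>The key of the new letter is \<open>int (Suc n)\<close> or its negative, which is
  extreme among all other keys and the initial 0; its sign selects the maximum or the minimum
  version of the insertion lemma.\<close>

lemma word_Des_insert_words:
  assumes w: "w \<in> words a n" and i: "i \<le> n"
  shows "card (word_Des L (insert_at i (c, Suc n) w)) = card (word_Des L w) +
    (if i \<in> word_Des L w \<or> i = n \<and> c \<notin> L then 0 else 1)"
proof -
  have len: "length (map (key L) w) = n"
    using w by (simp add: words_length)
  \<comment> \<open>Descent positions lie below \<open>n\<close>, so at \<open>i = n\<close> the
    color alone decides whether a descent is gained.\<close>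
  have n: "n \<notin> word_Des L w"
    by (simp add: word_Des_def descents_def words_length[OF w])
  have "\<bar>key L y\<bar> < int (Suc n)" if "y \<in> set w" for y
    using words_letter_less[OF w that] by (simp add: key_def)
  then have bound: "\<forall>y\<in>set (0 # map (key L) w). - int (Suc n) < y \<and> y < int (Suc n)"
    by (auto simp: abs_less_iff) (smt (verit))+
  show ?thesis
  proof (cases "c \<in> L")
    case True
    then show ?thesis
      using card_descents_insert_min[of 0 "map (key L) w" "- int (Suc n)" i] bound i n
      by (simp add: word_Des_def map_insert_at key_def len words_length[OF w])
  next
    case False
    then show ?thesis
      using card_descents_insert_max[of 0 "map (key L) w" "int (Suc n)" i] bound i n
      by (simp add: word_Des_def map_insert_at key_def len words_length[OF w])
  qed
qed

text \<open>Every insertion that creates a minimum, at the end with color in \<open>L\<close>, also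
  creates a descent, and no insertion lowers the number of descents.\<close>

lemma rlm_le_card_word_Des: "w \<in> words a n \<Longrightarrow> rlm L w \<le> card (word_Des L w)"
proof (induction n arbitrary: w)
  case 0
  then show ?case by (simp add: words_0)
next
  case (Suc n)
  then obtain v i c where v: "v \<in> words a n" "i \<le> n" "w = insert_at i (c, Suc n) v"
    using bij_betw_imp_surj_on[OF bij_betw_insert_words[of n a]] by force
  have "n \<notin> word_Des L v"
    by (simp add: word_Des_def descents_def words_length[OF v(1)])
  then show ?case
    using Suc.IH[OF v(1)] v by (auto simp: rlm_insert_words word_Des_insert_words)
qed

section \<open>Recurrences for the numbers of words\<close>

text \<open>Words of length \<open>Suc n\<close> are grouped by what remains after deleting the
  largest letter. The weights \<open>p\<close> and \<open>q\<close> count the admissible pairs of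
  position and color for each kind of remaining word.\<close>

lemma card_words_recurrence:
  assumes "\<And>w. w \<in> words a n \<Longrightarrow>
    int (card {(i, c). i \<le> n \<and> c < a \<and> P (insert_at i (c, Suc n) w)}) =
      (if Q w then p else 0) + (if R w then q else 0)"
  shows "int (card {w \<in> words a (Suc n). P w}) =
    p * int (card {w \<in> words a n. Q w}) + q * int (card {w \<in> words a n. R w})"
proof -
  let ?f = "\<lambda>(w, i, c). insert_at i (c, Suc n) w"
  let ?X = "SIGMA w:words a n. {(i, c). i \<le> n \<and> c < a \<and> P (insert_at i (c, Suc n) w)}"
  have fin: "finite {(i, c). i \<le> n \<and> c < a \<and> P (insert_at i (c, Suc n) w)}" for w
    by (rule finite_subset[of _ "{..n} \<times> {..<a}"]) auto
  have X: "?X = {x \<in> words a n \<times> {..n} \<times> {..<a}. P (?f x)}"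
    by auto
  have "h ` {x \<in> A. P (h x)} = {y \<in> h ` A. P y}"
    for h :: "(nat \<times> nat) list \<times> nat \<times> nat \<Rightarrow> (nat \<times> nat) list" and A
    by blast
  then have "?f ` ?X = {w \<in> ?f ` (words a n \<times> {..n} \<times> {..<a}). P w}"
    unfolding X .
  then have img: "?f ` ?X = {w \<in> words a (Suc n). P w}"
    by (simp only: bij_betw_imp_surj_on[OF bij_betw_insert_words])
  have inj: "inj_on ?f ?X"
    by (rule inj_on_subset[OF bij_betw_imp_inj_on[OF bij_betw_insert_words[of n a]]]) auto
  have "card {w \<in> words a (Suc n). P w} = card ?X"
    using card_image[OF inj] unfolding img .
  also have "\<dots> =
      (\<Sum>w\<in>words a n. card {(i, c). i \<le> n \<and> c < a \<and> P (insert_at i (c, Suc n) w)})"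
    by (intro card_SigmaI ballI finite_words fin)
  also have "int \<dots> = (\<Sum>w\<in>words a n. (if Q w then p else 0) + (if R w then q else 0))"
    unfolding of_nat_sum by (rule sum.cong) (simp_all only: assms)
  also have "\<dots> = (\<Sum>w\<in>{w \<in> words a n. Q w}. p) + (\<Sum>w\<in>{w \<in> words a n. R w}. q)"
    by (simp only: sum.distrib sum.inter_filter[OF finite_words])
  finally show ?thesis
    by simp
qed

text \<open>This makes the counts vanish for \<open>k\<close> above the length, as the boundary
  clause of \<open>g\<close> demands.\<close>

lemma rlm_le_length: "rlm L w \<le> length w"
proof -
  have "card (rlm_positions L w) \<le> card {..<length w}"
    by (rule card_mono) (auto simp: rlm_positions_def)
  then show ?thesis
    by (simp add: rlm_def)
qed

text \<open>Of the a(n+1) insertions into a word of length n, the \<open>card L\<close> ones at the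
  end with color in \<open>L\<close> raise \<open>rlm\<close> by one and all others preserve
  it.\<close>

lemma card_words_rlm:
  assumes L: "L \<subseteq> {..<a}"
  shows "int (card {w \<in> words a n. int (rlm L w) = k}) = g (int a) 0 (int (card L)) (int (card L)) n k"
proof (induction n arbitrary: k)
  case 0
  have "{w \<in> words a 0. int (rlm L w) = k} = (if k = 0 then {[]} else {})"
    by (auto simp: words_0)
  then show ?case by simp
next
  case (Suc n)
  let ?l = "int (card L)"
  have finL: "finite L"
    using L finite_subset by blast
  show ?case
  proof (cases "k < 0 \<or> k > int (Suc n)")
    case True
    have "int (rlm L w) \<noteq> k" if "w \<in> words a (Suc n)" for w
      using True rlm_le_length[of L w] words_length[OF that] by auto
    then have empty: "{w \<in> words a (Suc n). int (rlm L w) = k} = {}"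
      by blast
    show ?thesis
      unfolding empty using True by simp
  next
    case False
    have "int (card {w \<in> words a (Suc n). int (rlm L w) = k}) =
      (int a * int (Suc n) - ?l) * int (card {w \<in> words a n. int (rlm L w) = k}) +
      ?l * int (card {w \<in> words a n. int (rlm L w) = k - 1})"
    proof (rule card_words_recurrence)
      fix w assume w: "w \<in> words a n"
      have sub: "{n} \<times> L \<subseteq> {..n} \<times> {..<a}"
        using L by auto
      have "{(i, c). i \<le> n \<and> c < a \<and> int (rlm L (insert_at i (c, Suc n) w)) = k} =
        (if int (rlm L w) = k then {..n} \<times> {..<a} - {n} \<times> L
         else if int (rlm L w) = k - 1 then {n} \<times> L else {})"
        using L by (auto simp: rlm_insert_words[OF w] split: if_splits)
      moreover have "int (card ({..n} \<times> {..<a} - {n} \<times> L)) = int a * int (Suc n) - ?l"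
        using card_mono[OF _ sub]
        by (simp add: card_Diff_subset[OF _ sub] finL card_cartesian_product of_nat_diff algebra_simps)
      ultimately show "int (card {(i, c). i \<le> n \<and> c < a \<and>
          int (rlm L (insert_at i (c, Suc n) w)) = k}) =
        (if int (rlm L w) = k then int a * int (Suc n) - ?l else 0) +
        (if int (rlm L w) = k - 1 then ?l else 0)"
        by (simp add: card_cartesian_product)
    qed
    then show ?thesis
      using False by (simp add: Suc.IH)
  qed
qed

text \<open>Both statistics stay at k for ak insertions into the k descents and for the a -
  \<open>card L\<close> insertions at the end with color outside \<open>L\<close>; both rise from k
  - 1 to k for the \<open>card L\<close> remaining insertions at the end.\<close>

lemma card_words_Des_rlm:
  assumes L: "L \<subseteq> {..<a}"
  shows "int (card {w \<in> words a n. int (card (word_Des L w)) = k \<and> int (rlm L w) = k}) =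
    g 0 (int a) (int (card L) - int a) (int (card L)) n k"
proof (induction n arbitrary: k)
  case 0
  have "{w \<in> words a 0. int (card (word_Des L w)) = k \<and> int (rlm L w) = k} =
      (if k = 0 then {[]} else {})"
    by (auto simp: words_0 word_Des_def)
  then show ?case by simp
next
  case (Suc n)
  let ?l = "int (card L)"
  have finL: "finite L"
    using L finite_subset by blast
  let ?P = "\<lambda>k w. int (card (word_Des L w)) = k \<and> int (rlm L w) = k"
  show ?case
  proof (cases "k < 0 \<or> k > int (Suc n)")
    case True
    have "int (rlm L w) \<noteq> k" if "w \<in> words a (Suc n)" for w
      using True rlm_le_length[of L w] words_length[OF that] by auto
    then have empty: "{w \<in> words a (Suc n). ?P k w} = {}"
      by blast
    show ?thesis
      unfolding empty using True by simp
  next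
    case False
    have "int (card {w \<in> words a (Suc n). ?P k w}) =
      (int a * k - (?l - int a)) * int (card {w \<in> words a n. ?P k w}) +
      ?l * int (card {w \<in> words a n. ?P (k - 1) w})"
    proof (rule card_words_recurrence)
      fix w assume w: "w \<in> words a n"
      let ?D = "word_Des L w"
      have D: "?D \<subseteq> {..<n}"
        by (auto simp: word_Des_def descents_def words_length[OF w])
      have "finite ?D"
        by (simp add: word_Des_def)
      \<comment> \<open>Two ways of reaching (k, k) must be excluded: raising only
        \<open>rlm\<close> is impossible, and raising only the descents would start from
        \<open>rlm\<close> equal to k with k - 1 descents, against
        \<open>rlm_le_card_word_Des\<close>.\<close>
      have "?P k (insert_at i (c, Suc n) w) \<longleftrightarrow> (if ?P k w then i \<in> ?D \<or> i = n \<and> c \<notin> L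
          else ?P (k - 1) w \<and> i = n \<and> c \<in> L)" if "i \<le> n" for i c
      proof -
        have "n \<notin> ?D"
          using D by auto
        then show ?thesis
          using rlm_le_card_word_Des[OF w, of L]
          unfolding rlm_insert_words[OF w that] word_Des_insert_words[OF w that]
          by (cases "i = n"; cases "c \<in> L"; cases "i \<in> ?D") auto
      qed
      then have "{(i, c). i \<le> n \<and> c < a \<and> ?P k (insert_at i (c, Suc n) w)} =
          {(i, c). i \<le> n \<and> c < a \<and> (if ?P k w then i \<in> ?D \<or> i = n \<and> c \<notin> L
            else ?P (k - 1) w \<and> i = n \<and> c \<in> L)}"
        by (intro Collect_cong) (simp cong: conj_cong split: prod.split)
      also have "\<dots> = (if ?P k w then ?D \<times> {..<a} \<union> {n} \<times> ({..<a} - L)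
         else if ?P (k - 1) w then {n} \<times> L else {})"
        using L D by (cases "?P k w"; cases "?P (k - 1) w") (simp_all, auto)
      finally have "{(i, c). i \<le> n \<and> c < a \<and> ?P k (insert_at i (c, Suc n) w)} =
        (if ?P k w then ?D \<times> {..<a} \<union> {n} \<times> ({..<a} - L)
         else if ?P (k - 1) w then {n} \<times> L else {})" .
      moreover have "int (card (?D \<times> {..<a} \<union> {n} \<times> ({..<a} - L))) =
          int a * int (card ?D) - (?l - int a)"
      proof -
        have "(?D \<times> {..<a}) \<inter> ({n} \<times> ({..<a} - L)) = {}"
          using D by auto
        \<comment> \<open>This bound lets the subtraction of cardinalities pass from naturals to
          integers.\<close>
        moreover have "card L \<le> a"
          using card_mono[OF _ L] by simp
        ultimately show ?thesis
          using \<open>finite ?D\<close> L finL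
          by (simp add: card_Un_disjoint card_cartesian_product card_Diff_subset of_nat_diff)
      qed
      ultimately show "int (card {(i, c). i \<le> n \<and> c < a \<and> ?P k (insert_at i (c, Suc n) w)}) =
        (if ?P k w then int a * k - (?l - int a) else 0) + (if ?P (k - 1) w then ?l else 0)"
        by (auto simp: card_cartesian_product)
    qed
    then show ?thesis
      using False by (simp add: Suc.IH)
  qed
qed

section \<open>Decoding words into elements of the wreath product\<close>

text \<open>Since \<alpha>^a = 1, color exponents may be added freely and reduced only when a color
  below \<open>a\<close> is required.\<close>

lemma root_unity_power_mod:
  assumes "a \<ge> 1"
  shows "root_unity a ^ (u mod a) = root_unity a ^ u"
proof -
  have "root_unity a ^ a = 1"
    using assms by (simp add: root_unity_def DeMoivre)
  then have "root_unity a ^ (a * (u div a) + u mod a) = root_unity a ^ (u mod a)"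
    by (simp only: power_add power_mult power_one mult_1)
  then show ?thesis
    by simp
qed

lemma colored_in_colored_set:
  assumes "a \<ge> 1" "1 \<le> j" "j \<le> n"
  shows "colored a u j \<in> colored_set a n"
proof -
  have "colored a u j = colored a (u mod a) j"
    using assms by (simp add: colored_def root_unity_power_mod)
  moreover have "u mod a < a"
    using assms by simp
  ultimately show ?thesis
    using assms unfolding colored_set_def by blast
qed

lemma root_unity_nonzero [simp]: "root_unity a \<noteq> 0"
  by (simp add: root_unity_def)

text \<open>For z = \<alpha>^v j the quotient by the modulus recovers \<alpha>^v, and the modulus
  recovers j, whose letter stands at list index j - 1. Outside the colored set the map is the
  identity, matching \<open>permutes\<close>.\<close>

definition decode :: "nat \<Rightarrow> nat \<Rightarrow> (nat \<times> nat) list \<Rightarrow> complex \<Rightarrow> complex" where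
  "decode a n w z = (if z \<in> colored_set a n
     then z / of_real (cmod z) * (case w ! (nat \<lfloor>cmod z\<rfloor> - 1) of (c, j) \<Rightarrow> colored a c j) else z)"

lemma decode_colored:
  assumes "a \<ge> 1" "i < n"
  shows "decode a n w (colored a v (Suc i)) =
    root_unity a ^ v * colored a (fst (w ! i)) (snd (w ! i))"
proof -
  have "colored a v (Suc i) / of_real (cmod (colored a v (Suc i))) = root_unity a ^ v"
    unfolding cmod_colored by (simp add: colored_def del: of_nat_Suc)
  then show ?thesis
    using assms colored_in_colored_set[of a "Suc i" n v]
    by (simp add: decode_def cmod_colored case_prod_beta del: of_nat_Suc)
qed

lemma decode_of_nat:
  assumes "a \<ge> 1" "i < n"
  shows "decode a n w (of_nat (Suc i)) = colored a (fst (w ! i)) (snd (w ! i))"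
  using decode_colored[OF assms, of w 0] by (simp add: colored_def del: of_nat_Suc)

lemma decode_0: "decode a n w 0 = 0"
  by (simp add: decode_def)

lemma words_nth:
  assumes "w \<in> words a n" "i < n"
  shows "fst (w ! i) < a" "1 \<le> snd (w ! i)" "snd (w ! i) \<le> n"
  using words_letter[OF assms(1), of "w ! i"] assms by (simp_all add: words_length)

lemma words_snd_inject:
  assumes "w \<in> words a n" "i < n" "j < n" "snd (w ! i) = snd (w ! j)"
  shows "i = j"
  using assms nth_eq_iff_index_eq[of "map snd w" i j] by (auto simp: words_def)

lemma colored_setE:
  assumes "z \<in> colored_set a n"
  obtains v i where "v < a" "i < n" "z = colored a v (Suc i)"
proof -
  obtain v j where "v < a" "1 \<le> j" "j \<le> n" "z = colored a v j"
    using assms by (auto simp: colored_set_def)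
  then show ?thesis
    using that[of v "j - 1"] by simp
qed

text \<open>Equivariance is built into the factor z / |z|. For injectivity, equal images have equal
  moduli, hence come from the same letter; cancelling it leaves equal powers of \<alpha>.\<close>

lemma decode_in_wreath:
  assumes a: "a \<ge> 1" and w: "w \<in> words a n"
  shows "decode a n w \<in> wreath a n"
proof -
  have mem: "decode a n w z \<in> colored_set a n" if z: "z \<in> colored_set a n" for z
  proof -
    obtain v i where *: "v < a" "i < n" "z = colored a v (Suc i)"
      using colored_setE[OF z] by blast
    then have "decode a n w z = colored a (v + fst (w ! i)) (snd (w ! i))"
      using a by (simp add: decode_colored) (simp add: colored_def power_add)
    then show ?thesis
      using colored_in_colored_set[OF a] words_nth[OF w] * by simp
  qed
  have "inj_on (decode a n w) (colored_set a n)"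
  proof (rule inj_onI)
    fix y z assume y: "y \<in> colored_set a n" and z: "z \<in> colored_set a n"
      and eq: "decode a n w y = decode a n w z"
    obtain u i where u: "u < a" "i < n" "y = colored a u (Suc i)"
      using colored_setE[OF y] by blast
    obtain v j where v: "v < a" "j < n" "z = colored a v (Suc j)"
      using colored_setE[OF z] by blast
    have e: "root_unity a ^ u * colored a (fst (w ! i)) (snd (w ! i)) =
        root_unity a ^ v * colored a (fst (w ! j)) (snd (w ! j))"
      using eq a u v by (simp add: decode_colored)
    then have "cmod (root_unity a ^ u * colored a (fst (w ! i)) (snd (w ! i))) =
        cmod (root_unity a ^ v * colored a (fst (w ! j)) (snd (w ! j)))"
      by simp
    then have "snd (w ! i) = snd (w ! j)"
      by (simp add: norm_mult norm_power cmod_colored) (simp add: root_unity_def)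
    then have ij: "i = j"
      using words_snd_inject[OF w] u v by blast
    then have "root_unity a ^ u = root_unity a ^ v"
      using e words_nth[OF w u(2)] by (auto simp: colored_def)
    then show "y = z"
      by (simp add: u v ij colored_def)
  qed
  then have "bij_betw (decode a n w) (colored_set a n) (colored_set a n)"
    \<comment> \<open>An injective self-map of a finite set is surjective.\<close>
    using mem by (simp add: bij_betw_def endo_inj_surj finite_colored_set image_subsetI)
  then have "decode a n w permutes colored_set a n"
    by (rule bij_imp_permutes) (simp add: decode_def)
  moreover have "decode a n w (root_unity a ^ t * z) = root_unity a ^ t * decode a n w z"
    if z: "z \<in> colored_set a n" for t z
  proof -
    obtain v i where *: "v < a" "i < n" "z = colored a v (Suc i)"
      using colored_setE[OF z] by blast
    have "root_unity a ^ t * z = colored a (t + v) (Suc i)"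
      by (simp add: * colored_def power_add)
    then show ?thesis
      using a * by (simp add: decode_colored power_add)
  qed
  ultimately show ?thesis
    by (simp add: wreath_def)
qed

text \<open>The preimage is the word of the values at 1, ..., n; by equivariance these values
  determine \<open>s\<close> on the whole colored set.\<close>

lemma decode_surj:
  assumes a: "a \<ge> 1" and s: "s \<in> wreath a n"
  shows "\<exists>w\<in>words a n. decode a n w = s"
proof -
  have perm: "s permutes colored_set a n"
    and equiv: "\<And>t x. t < a \<Longrightarrow> x \<in> colored_set a n \<Longrightarrow>
      s (root_unity a ^ t * x) = root_unity a ^ t * s x"
    using s by (auto simp: wreath_def)
  have mem: "of_nat (Suc i) \<in> colored_set a n" if "i < n" for i
    using colored_in_colored_set[OF a, of "Suc i" n 0] that by (simp add: colored_def)
  have "\<exists>x. fst x < a \<and> 1 \<le> snd x \<and> snd x \<le> n \<and> s (of_nat (Suc i)) = colored a (fst x) (snd x)"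
    if "i < n" for i
  proof -
    have "s (of_nat (Suc i)) \<in> colored_set a n"
      using permutes_in_image[OF perm] mem[OF that] by blast
    then show ?thesis
      by (auto simp: colored_set_def)
  qed
  then obtain f where f: "\<And>i. i < n \<Longrightarrow> fst (f i) < a \<and> 1 \<le> snd (f i) \<and> snd (f i) \<le> n \<and>
      s (of_nat (Suc i)) = colored a (fst (f i)) (snd (f i))"
    by metis
  define w where "w = map f [0..<n]"
  have "inj_on (\<lambda>i. snd (f i)) {0..<n}"
  proof (rule inj_onI)
    fix i j assume ij: "i \<in> {0..<n}" "j \<in> {0..<n}" "snd (f i) = snd (f j)"
    text \<open>Letters of equal absolute value differ by a power of \<open>\<alpha>\<close>, so by equivariance their
      positions do.\<close>
    define t where "t = (fst (f i) + (a - fst (f j))) mod a"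
    \<comment> \<open>The natural number \<open>a - fst (f j)\<close> represents the exponent
      \<open>- fst (f j)\<close> modulo \<open>a\<close>, so this power of \<alpha> turns the color
      of the value at \<open>Suc j\<close> into that of the value at \<open>Suc i\<close>.\<close>
    have "root_unity a ^ t * s (of_nat (Suc j)) =
        root_unity a ^ (fst (f i) + (a - fst (f j))) * root_unity a ^ fst (f j) * of_nat (snd (f i))"
      using f[of j] ij a by (simp add: t_def root_unity_power_mod colored_def)
    also have "\<dots> = root_unity a ^ (fst (f i) + a) * of_nat (snd (f i))"
      using f[of j] ij by (simp flip: power_add)
    also have "\<dots> = root_unity a ^ fst (f i) * of_nat (snd (f i))"
      using root_unity_power_mod[OF a, of "fst (f i) + a"] root_unity_power_mod[OF a, of "fst (f i)"]
      by simp
    also have "\<dots> = s (of_nat (Suc i))"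
      using f[of i] ij by (simp add: colored_def)
    finally have "s (root_unity a ^ t * of_nat (Suc j)) = s (of_nat (Suc i))"
      using equiv[of t "of_nat (Suc j)"] mem[of j] ij a by (simp add: t_def)
    then have "root_unity a ^ t * of_nat (Suc j) = of_nat (Suc i)"
      using permutes_inj[OF perm] by (meson injD)
    then have "cmod (colored a t (Suc j)) = cmod (colored a 0 (Suc i))"
      by (simp add: colored_def)
    then show "i = j"
      by (simp add: cmod_colored)
  qed
  then have dist: "distinct (map snd w)"
    by (simp add: w_def distinct_map comp_def)
  then have card: "card (snd ` set w) = n"
    using distinct_card[of "map snd w"] by (simp add: w_def image_comp)
  have "snd ` set w \<subseteq> {1..n}"
    using f by (auto simp: w_def)
  \<comment> \<open>A subset of {1..n} with n elements is all of it.\<close>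
  then have "snd ` set w = {1..n}"
    using card by (intro card_subset_eq) auto
  then have w: "w \<in> words a n"
    using dist f by (auto simp: words_def w_def)
  have "decode a n w z = s z" for z
  proof (cases "z \<in> colored_set a n")
    case True
    obtain v i where *: "v < a" "i < n" "z = colored a v (Suc i)"
      using colored_setE[OF True] by blast
    have "s z = root_unity a ^ v * s (of_nat (Suc i))"
      using equiv[OF *(1) mem[OF *(2)]] by (simp add: * colored_def)
    also have "\<dots> = decode a n w z"
      using * a f[of i] by (simp add: decode_colored w_def)
    finally show ?thesis ..
  next
    case False
    then show ?thesis
      using permutes_not_in[OF perm] by (simp add: decode_def)
  qed
  with w show ?thesis
    by blast
qed

lemma bij_betw_decode:
  assumes a: "a \<ge> 1"
  shows "bij_betw (decode a n) (words a n) (wreath a n)"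
proof (rule bij_betw_imageI)
  show "inj_on (decode a n) (words a n)"
  proof (rule inj_onI)
    fix w w' assume w: "w \<in> words a n" and w': "w' \<in> words a n" and eq: "decode a n w = decode a n w'"
    show "w = w'"
    proof (rule nth_equalityI)
      show "length w = length w'"
        using w w' by (simp add: words_length)
      fix i assume "i < length w"
      then have i: "i < n"
        using w by (simp add: words_length)
      have "colored a (fst (w ! i)) (snd (w ! i)) = colored a (fst (w' ! i)) (snd (w' ! i))"
        using decode_of_nat[OF a i] eq by metis
      then show "w ! i = w' ! i"
        using colored_inject words_nth[OF w i] words_nth[OF w' i] prod_eqI by blast
    qed
  qed
  show "decode a n ` words a n = wreath a n"
    using decode_in_wreath[OF a] decode_surj[OF a] by blast
qed

section \<open>Transfer of the statistics to the wreath product\<close>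

text \<open>The values counted by \<open>rl_min\<close> are the absolute values at the positions
  counted by \<open>rlm\<close>, and a word takes distinct absolute values at distinct
  positions.\<close>

lemma rl_min_decode:
  assumes a: "a \<ge> 1" and L: "L \<subseteq> {..<a}" and w: "w \<in> words a n"
  shows "rl_min a L n (decode a n w) = rlm L w"
proof -
  let ?s = "decode a n w"
  have cm: "cmod (?s (of_nat (Suc i))) = real (snd (w ! i))" if "i < n" for i
    using decode_of_nat[OF a that, of w] by (simp add: cmod_colored)
  \<comment> \<open>A nonzero letter has a unique color exponent below \<open>a\<close>, and
    \<open>L\<close> contains only such exponents.\<close>
  have color: "(\<exists>u\<in>L. ?s (of_nat (Suc i)) = root_unity a ^ u * of_real (cmod (?s (of_nat (Suc i)))))
      \<longleftrightarrow> fst (w ! i) \<in> L" if i: "i < n" for i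
  proof -
    have "fst (w ! i) = u" if "u \<in> L" "colored a (fst (w ! i)) (snd (w ! i)) = colored a u (snd (w ! i))" for u
      using colored_inject[of "fst (w ! i)" a u "snd (w ! i)" "snd (w ! i)"] words_nth[OF w i] that L
      by auto
    then have "(\<exists>u\<in>L. colored a (fst (w ! i)) (snd (w ! i)) = colored a u (snd (w ! i))) \<longleftrightarrow>
        fst (w ! i) \<in> L"
      by blast
    then show ?thesis
      by (simp add: decode_of_nat[OF a i] cmod_colored del: of_nat_Suc)
        (simp add: colored_def)
  qed
  define C where "C i \<longleftrightarrow>
    (\<forall>j. i < j \<and> j \<le> n \<longrightarrow> cmod (?s (of_nat i)) < cmod (?s (of_nat j))) \<and>
    (\<exists>u\<in>L. ?s (of_nat i) = root_unity a ^ u * of_real (cmod (?s (of_nat i))))" for i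
  have C: "C (Suc i) \<longleftrightarrow> i \<in> rlm_positions L w" if i: "i < n" for i
  proof -
    have "(\<forall>j. Suc i < j \<and> j \<le> n \<longrightarrow> Q j) \<longleftrightarrow> (\<forall>j. i < j \<and> j < n \<longrightarrow> Q (Suc j))" for Q
      by (metis Suc_le_eq Suc_less_eq2)
    then show ?thesis
      using color[OF i] cm i by (simp add: C_def rlm_positions_def words_length[OF w] del: of_nat_Suc)
        blast
  qed
  \<comment> \<open>Arguments of the group element start at 1, list indices at 0.\<close>
  have "{i. 1 \<le> i \<and> i \<le> n \<and> C i} = Suc ` rlm_positions L w"
  proof (intro equalityI subsetI)
    fix i assume "i \<in> {i. 1 \<le> i \<and> i \<le> n \<and> C i}"
    then show "i \<in> Suc ` rlm_positions L w"
      using C[of "i - 1"] by (auto intro!: image_eqI[of _ _ "i - 1"])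
  next
    fix i assume "i \<in> Suc ` rlm_positions L w"
    then show "i \<in> {i. 1 \<le> i \<and> i \<le> n \<and> C i}"
      using C by (auto simp: rlm_positions_def words_length[OF w])
  qed
  moreover have "rl_Min a L n ?s = (\<lambda>i. cmod (?s (of_nat i))) ` {i. 1 \<le> i \<and> i \<le> n \<and> C i}"
    unfolding rl_Min_def C_def by blast
  ultimately have "rl_Min a L n ?s = (\<lambda>i. cmod (?s (of_nat (Suc i)))) ` rlm_positions L w"
    by (simp only: image_image)
  also have "\<dots> = (\<lambda>i. real (snd (w ! i))) ` rlm_positions L w"
    using cm by (intro image_cong) (auto simp: rlm_positions_def words_length[OF w] simp del: of_nat_Suc)
  finally have "rl_Min a L n ?s = (\<lambda>i. real (snd (w ! i))) ` rlm_positions L w" .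
  moreover have "inj_on (\<lambda>i. real (snd (w ! i))) (rlm_positions L w)"
    using words_snd_inject[OF w] by (auto simp: inj_on_def rlm_positions_def words_length[OF w])
  ultimately show ?thesis
    by (simp add: rl_min_def rlm_def card_image)
qed

text \<open>Distinct absolute values put two letters of the same class where \<open>L_order\<close>
  prescribes the comparison; letters of different classes are separated by 0.\<close>

lemma L_order_iff_key_less:
  assumes r: "L_order a L n r" and L: "L \<subseteq> {..<a}"
    and x: "fst x < a" "snd x \<in> {1..n}" and y: "fst y < a" "snd y \<in> {1..n}"
    and ne: "snd x \<noteq> snd y"
  shows "(colored a (fst x) (snd x), colored a (fst y) (snd y)) \<in> r \<longleftrightarrow> key L x < key L y"
proof -
  let ?U = "{..<a} - L"
  have tr: "trans r" and irr: "irrefl r"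
    using r by (auto simp: L_order_def Let_def strict_linear_order_on_def)
  have neg: "(colored a v j, 0) \<in> r" if "v \<in> L" "j \<in> {1..n}" for v j
    using r that by (simp add: L_order_def Let_def)
  have pos: "(0, colored a v j) \<in> r" if "v \<in> ?U" "j \<in> {1..n}" for v j
    using r that by (simp add: L_order_def Let_def)
  have LL: "(colored a v i, colored a u j) \<in> r \<longleftrightarrow> i > j"
    if "u \<in> L" "v \<in> L" "i \<in> {1..n}" "j \<in> {1..n}" "i \<noteq> j" for u v i j
    using r that by (simp add: L_order_def Let_def)
  have UU: "(colored a v i, colored a u j) \<in> r \<longleftrightarrow> i < j"
    if "u \<in> ?U" "v \<in> ?U" "i \<in> {1..n}" "j \<in> {1..n}" "i \<noteq> j" for u v i j
    using r that by (simp add: L_order_def Let_def)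
  \<comment> \<open>Transitivity through 0 gives the first relation; the reverse one would
    contradict irreflexivity.\<close>
  have LU: "(colored a v i, colored a u j) \<in> r" "(colored a u j, colored a v i) \<notin> r"
    if "v \<in> L" "u \<in> ?U" "i \<in> {1..n}" "j \<in> {1..n}" for u v i j
    using neg[of v i] pos[of u j] that tr irr by (meson irrefl_def transD)+
  show ?thesis
    using x y ne LL UU LU by (cases "fst x \<in> L"; cases "fst y \<in> L") (auto simp: key_def)
qed

text \<open>Position 0 is a descent exactly when the first color lies in \<open>L\<close>, which is
  when its key is negative. At later positions the neighbours have distinct absolute values, so keys
  decide the comparison.\<close>

lemma des_decode:
  assumes a: "a \<ge> 1" and L: "L \<subseteq> {..<a}" and r: "L_order a L n r" and w: "w \<in> words a n"
  shows "des n r (decode a n w) = card (word_Des L w)"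
proof -
  let ?s = "decode a n w"
  have tr: "trans r" and irr: "irrefl r"
    using r by (auto simp: L_order_def Let_def strict_linear_order_on_def)
  have neg: "(colored a v j, 0) \<in> r" if "v \<in> L" "j \<in> {1..n}" for v j
    using r that by (simp add: L_order_def Let_def)
  have pos: "(0, colored a v j) \<in> r" if "v < a" "v \<notin> L" "j \<in> {1..n}" for v j
    using r that by (simp add: L_order_def Let_def)
  have "(?s (of_nat (i + 1)), ?s (of_nat i)) \<in> r \<longleftrightarrow>
      map (key L) w ! i < (0 # map (key L) w) ! i" if i: "i < n" for i
  proof (cases i)
    case 0
    let ?x = "w ! 0"
    have x: "fst ?x < a" "snd ?x \<in> {1..n}"
      using words_nth[OF w, of 0] i 0 by auto
    have "(colored a (fst ?x) (snd ?x), 0) \<in> r \<longleftrightarrow> fst ?x \<in> L"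
      using neg pos x tr irr by (meson irrefl_def transD)
    then show ?thesis
      using decode_of_nat[OF a, of 0 n w] i 0 x words_length[OF w]
      by (simp add: decode_0 key_def)
  next
    case (Suc m)
    have "snd (w ! i) \<noteq> snd (w ! m)"
      using words_snd_inject[OF w, of i m] i Suc by auto
    then have "(colored a (fst (w ! i)) (snd (w ! i)), colored a (fst (w ! m)) (snd (w ! m))) \<in> r
        \<longleftrightarrow> key L (w ! i) < key L (w ! m)"
      using words_nth[OF w, of i] words_nth[OF w, of m] i Suc
      by (intro L_order_iff_key_less[OF r L]) auto
    then show ?thesis
      using decode_of_nat[OF a, of i n w] decode_of_nat[OF a, of m n w] i Suc words_length[OF w]
      by (simp del: of_nat_Suc)
  qed
  then have "Des n r ?s = word_Des L w"
    by (auto simp: Des_def word_Des_def descents_def words_length[OF w])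
  then show ?thesis
    by (simp add: des_def)
qed

text \<open>The bijection \<open>decode\<close> carries any count in the wreath product to a count
  of words.\<close>

lemma card_wreath_eq_card_words:
  assumes a: "a \<ge> 1" and PQ: "\<And>w. w \<in> words a n \<Longrightarrow> P (decode a n w) \<longleftrightarrow> Q w"
  shows "card {s \<in> wreath a n. P s} = card {w \<in> words a n. Q w}"
proof -
  have "{s \<in> wreath a n. P s} = decode a n ` {w \<in> words a n. Q w}"
    using bij_betw_imp_surj_on[OF bij_betw_decode[OF a, of n]] PQ by force
  moreover have "inj_on (decode a n) {w \<in> words a n. Q w}"
    by (rule inj_on_subset[OF bij_betw_imp_inj_on[OF bij_betw_decode[OF a, of n]]]) auto
  ultimately show ?thesis
    by (simp add: card_image)
qed

theorem theorem1p1: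
  fixes a n :: nat and L :: "nat set" and k :: int
  assumes "a \<ge> 1" and "L \<subseteq> {0..<a}"
  shows "g (int a) 0 (int (card L)) (int (card L)) n k = int (card (A_set a L n k)) \<and>
    (\<forall>r. L_order a L n r \<longrightarrow>
      g 0 (int a) (int (card L) - int a) (int (card L)) n k = int (card (B_set a L r n k)))"
proof (intro conjI allI impI)
  have L: "L \<subseteq> {..<a}"
    using assms(2) by (simp add: atLeast0LessThan)
  have "card (A_set a L n k) = card {w \<in> words a n. int (rlm L w) = k}"
    unfolding A_set_def
    by (rule card_wreath_eq_card_words[OF assms(1)]) (simp add: rl_min_decode[OF assms(1) L])
  then show "g (int a) 0 (int (card L)) (int (card L)) n k = int (card (A_set a L n k))"
    by (simp add: card_words_rlm[OF L])
  fix r assume r: "L_order a L n r"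
  have "card (B_set a L r n k) =
      card {w \<in> words a n. int (card (word_Des L w)) = k \<and> int (rlm L w) = k}"
    unfolding B_set_def
    by (rule card_wreath_eq_card_words[OF assms(1)])
      (simp add: rl_min_decode[OF assms(1) L] des_decode[OF assms(1) L r])
  then show "g 0 (int a) (int (card L) - int a) (int (card L)) n k = int (card (B_set a L r n k))"
    by (simp add: card_words_Des_rlm[OF L])
qed

end
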